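(* The class of dominated dcpos is $\Gamma$-faithful: for any two dominated dcpos $D$ and $E$, if $\Gamma(D)\cong\Gamma(E)$ (as ordered sets) then $D\cong E$ (as ordered sets).
   Context: For a dcpo $D$, $\Gamma(D)$ denotes the complete lattice of Scott-closed subsets of $D$, ordered by inclusion. A subset of $D$ is irreducible if it is nonempty and whenever it is contained in a union $B\cup C$ of two Scott-closed sets it is contained in $B$ or in $C$; "closed irreducible" means Scott-closed and irreducible in the Scott topology. $\mathsf{Irr}(D)$ denotes the set of closed irreducible subsets of $D$ ordered by inclusion. For $A',A\in\mathsf{Irr}(D)$ write $A'\triangleleft A$ if there is $x\in A$ with $A'\subseteq{\downarrow}x$, and $\nabla A=\{A'\in\mathsf{Irr}(D)\mid A'\triangleleft A\}$. A dcpo $D$ is dominated if for every $A\in\mathsf{Irr}(D)$ the collection $\nabla A$ is Scott-closed in the poset $\mathsf{Irr}(D)$. A class $\mathbf{C}$ of posets is $\Gamma$-faithful if for all $P,Q\in\mathbf{C}$, $\Gamma(P)\cong\Gamma(Q)$ implies $P\cong Q$. *)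

theory Defs
  imports "HOL-Algebra.Order"
begin

definition order_isomorphic :: "('a, 'm) gorder_scheme \<Rightarrow> ('b, 'n) gorder_scheme \<Rightarrow> bool" where
  "order_isomorphic L M \<longleftrightarrow>
    (\<exists>f. order_emb L M f \<and> bij_betw f (carrier L) (carrier M))"

definition directed :: "('a, 'm) gorder_scheme \<Rightarrow> 'a set \<Rightarrow> bool" where
  "directed L S \<longleftrightarrow>
    S \<subseteq> carrier L \<and> S \<noteq> {} \<and> (\<forall>x\<in>S. \<forall>y\<in>S. \<exists>z\<in>S. x \<sqsubseteq>\<^bsub>L\<^esub> z \<and> y \<sqsubseteq>\<^bsub>L\<^esub> z)"

locale dcpo = partial_order +
  assumes directed_sup_exists: "directed L S \<Longrightarrow> \<exists>s. is_lub L s S"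

text \<open>Scott-closedness is stated for arbitrary posets, so in the last clause
  only those directed suprema that exist are required to belong to the set.\<close>

definition scott_closed :: "('a, 'm) gorder_scheme \<Rightarrow> 'a set \<Rightarrow> bool" where
  "scott_closed L C \<longleftrightarrow>
    C \<subseteq> carrier L \<and>
    (\<forall>x\<in>C. \<forall>y\<in>carrier L. y \<sqsubseteq>\<^bsub>L\<^esub> x \<longrightarrow> y \<in> C) \<and>
    (\<forall>S s. directed L S \<longrightarrow> S \<subseteq> C \<longrightarrow> is_lub L s S \<longrightarrow> s \<in> C)"

definition irreducible :: "('a, 'm) gorder_scheme \<Rightarrow> 'a set \<Rightarrow> bool" where
  "irreducible L A \<longleftrightarrow>
    A \<subseteq> carrier L \<and> A \<noteq> {} \<and>
    (\<forall>B C. scott_closed L B \<longrightarrow> scott_closed L C \<longrightarrow> A \<subseteq> B \<union> C \<longrightarrow> A \<subseteq> B \<or> A \<subseteq> C)"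

definition inclusion_order :: "'a set set \<Rightarrow> 'a set gorder" where
  "inclusion_order X = \<lparr>carrier = X, eq = (=), le = (\<subseteq>)\<rparr>"

definition Gamma :: "('a, 'm) gorder_scheme \<Rightarrow> 'a set gorder" where
  "Gamma L = inclusion_order {C. scott_closed L C}"

definition Irr :: "('a, 'm) gorder_scheme \<Rightarrow> 'a set gorder" where
  "Irr L = inclusion_order {A. scott_closed L A \<and> irreducible L A}"

definition down :: "('a, 'm) gorder_scheme \<Rightarrow> 'a \<Rightarrow> 'a set" where
  "down L x = {y \<in> carrier L. y \<sqsubseteq>\<^bsub>L\<^esub> x}"

definition triangle_below :: "('a, 'm) gorder_scheme \<Rightarrow> 'a set \<Rightarrow> 'a set \<Rightarrow> bool" where
  "triangle_below L A' A \<longleftrightarrow> (\<exists>x\<in>A. A' \<subseteq> down L x)"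

definition nabla :: "('a, 'm) gorder_scheme \<Rightarrow> 'a set \<Rightarrow> 'a set set" where
  "nabla L A = {A' \<in> carrier (Irr L). triangle_below L A' A}"

locale dominated_dcpo = dcpo +
  assumes nabla_scott_closed: "A \<in> carrier (Irr L) \<Longrightarrow> scott_closed (Irr L) (nabla L A)"

lemma partial_order_inclusion_order: "partial_order (inclusion_order X)"
  by standard (auto simp: inclusion_order_def)

lemma partial_order_Gamma: "partial_order (Gamma L)"
  and partial_order_Irr: "partial_order (Irr L)"
  by (simp_all add: Gamma_def Irr_def partial_order_inclusion_order)

end

(* Write eta x for the principal ideal of x, a closed irreducible set. If S is a Scott-closed family
   of closed irreducible sets, its preimage under eta is a Scott-closed set containing every member
   of S. Hence whenever eta x is the supremum of S in Gamma, x lies in that preimage, that is, eta x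
   belongs to S. Conversely, A is the supremum of nabla A, so if A has the same property and D is
   dominated, then A belongs to nabla A, which forces A to be principal. Thus the principal ideals
   are characterised inside the lattice Gamma, and an isomorphism of the lattices restricts to one of
   the posets of principal ideals. *)

theory Submission
  imports Defs
begin

section \<open>Suprema, join primes and compactness among join primes\<close>

lemma is_lub_iff:
  "is_lub L s S \<longleftrightarrow> s \<in> carrier L \<and> (\<forall>x\<in>S \<inter> carrier L. x \<sqsubseteq>\<^bsub>L\<^esub> s) \<and>
    (\<forall>u\<in>carrier L. (\<forall>x\<in>S \<inter> carrier L. x \<sqsubseteq>\<^bsub>L\<^esub> u) \<longrightarrow> s \<sqsubseteq>\<^bsub>L\<^esub> u)"
  by (auto simp: least_def Upper_def)

text \<open>In \<open>Gamma L\<close> these are the closed irreducible sets. Requiring some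
  \<open>b\<close> not above \<open>a\<close> excludes a least element, which corresponds to
  nonemptiness. Only those binary joins that exist are tested.\<close>

definition join_prime :: "('a, 'm) gorder_scheme \<Rightarrow> 'a \<Rightarrow> bool" where
  "join_prime L a \<longleftrightarrow> a \<in> carrier L \<and> (\<exists>b\<in>carrier L. \<not> a \<sqsubseteq>\<^bsub>L\<^esub> b) \<and>
    (\<forall>b\<in>carrier L. \<forall>c\<in>carrier L. \<forall>d. is_lub L d {b, c} \<longrightarrow> a \<sqsubseteq>\<^bsub>L\<^esub> d \<longrightarrow>
      a \<sqsubseteq>\<^bsub>L\<^esub> b \<or> a \<sqsubseteq>\<^bsub>L\<^esub> c)"

definition primes :: "('a, 'm) gorder_scheme \<Rightarrow> ('a, 'm) gorder_scheme" where
  "primes L = L\<lparr>carrier := {a. join_prime L a}\<rparr>"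

(* The supremum is taken in L, not in the poset of primes: a supremum computed among the primes
   could be larger, and then principal ideals need not be compact. *)
definition prime_compact :: "('a, 'm) gorder_scheme \<Rightarrow> 'a \<Rightarrow> bool" where
  "prime_compact L a \<longleftrightarrow> join_prime L a \<and>
    (\<forall>S. scott_closed (primes L) S \<longrightarrow> is_lub L a S \<longrightarrow> a \<in> S)"

section \<open>Transport along order isomorphisms\<close>

locale order_iso =
  fixes L :: "('a, 'm) gorder_scheme" and M :: "('b, 'n) gorder_scheme" and f :: "'a \<Rightarrow> 'b"
  assumes le_iff: "x \<in> carrier L \<Longrightarrow> y \<in> carrier L \<Longrightarrow> f x \<sqsubseteq>\<^bsub>M\<^esub> f y \<longleftrightarrow> x \<sqsubseteq>\<^bsub>L\<^esub> y"
    and bij: "bij_betw f (carrier L) (carrier M)"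
begin

lemma map_closed: "x \<in> carrier L \<Longrightarrow> f x \<in> carrier M"
  using bij by (auto simp: bij_betw_def)

lemma image_carrier: "carrier M = f ` carrier L"
  using bij by (auto simp: bij_betw_def)

lemma inverse: "order_iso M L (inv_into (carrier L) f)"
proof
  show "bij_betw (inv_into (carrier L) f) (carrier M) (carrier L)"
    using bij by (rule bij_betw_inv_into)
next
  fix x y assume "x \<in> carrier M" "y \<in> carrier M"
  then obtain a b where "a \<in> carrier L" "b \<in> carrier L" "x = f a" "y = f b"
    by (auto simp: image_carrier)
  then show "inv_into (carrier L) f x \<sqsubseteq>\<^bsub>L\<^esub> inv_into (carrier L) f y \<longleftrightarrow> x \<sqsubseteq>\<^bsub>M\<^esub> y"
    by (simp add: bij_betw_inv_into_left[OF bij] le_iff)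
qed

text \<open>By surjectivity every element of \<open>M\<close> is some \<open>f u\<close>, and
  \<open>f u\<close> bounds the image of \<open>S\<close> exactly when \<open>u\<close> bounds
  \<open>S\<close>.\<close>

lemma is_lub_image:
  assumes "S \<subseteq> carrier L" "s \<in> carrier L"
  shows "is_lub M (f s) (f ` S) \<longleftrightarrow> is_lub L s S"
proof -
  have S: "S \<inter> carrier L = S" "f ` S \<inter> carrier M = f ` S"
    using assms by (auto simp: map_closed)
  have ub: "(\<forall>x\<in>f ` S. x \<sqsubseteq>\<^bsub>M\<^esub> f u) \<longleftrightarrow> (\<forall>x\<in>S. x \<sqsubseteq>\<^bsub>L\<^esub> u)" if "u \<in> carrier L" for u
    using that assms(1) le_iff by blast
  have least: "(\<forall>u\<in>carrier M. (\<forall>x\<in>f ` S. x \<sqsubseteq>\<^bsub>M\<^esub> u) \<longrightarrow> f s \<sqsubseteq>\<^bsub>M\<^esub> u) \<longleftrightarrow>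
      (\<forall>u\<in>carrier L. (\<forall>x\<in>S. x \<sqsubseteq>\<^bsub>L\<^esub> u) \<longrightarrow> s \<sqsubseteq>\<^bsub>L\<^esub> u)"
    unfolding image_carrier using assms(2) by (simp add: ub[simplified] le_iff)
  show ?thesis
    unfolding is_lub_iff S using least assms(2) by (simp only: ub map_closed simp_thms)
qed

lemma directed_image: "directed L S \<Longrightarrow> directed M (f ` S)"
  unfolding directed_def by (auto simp: image_carrier) (metis le_iff subsetD)

text \<open>An order isomorphism preserves directed sets and existing suprema, so it is
  Scott-continuous.\<close>

lemma scott_closed_vimage:
  assumes C: "scott_closed M C"
  shows "scott_closed L {x \<in> carrier L. f x \<in> C}"
  unfolding scott_closed_def
proof (intro conjI ballI allI impI)
  fix x y assume "x \<in> {x \<in> carrier L. f x \<in> C}" "y \<in> carrier L" "y \<sqsubseteq>\<^bsub>L\<^esub> x"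
  then show "y \<in> {x \<in> carrier L. f x \<in> C}"
    using C unfolding scott_closed_def by (auto simp: le_iff map_closed)
next
  fix S s assume S: "directed L S" "S \<subseteq> {x \<in> carrier L. f x \<in> C}" "is_lub L s S"
  then have s: "s \<in> carrier L" by (simp add: is_lub_iff)
  have "is_lub M (f s) (f ` S)"
    using S s by (subst is_lub_image) auto
  then have "f s \<in> C"
    using C S directed_image[OF S(1)] unfolding scott_closed_def by blast
  with s show "s \<in> {x \<in> carrier L. f x \<in> C}" by simp
qed auto

lemma join_prime_map:
  assumes a: "join_prime L a"
  shows "join_prime M (f a)"
proof -
  have aL: "a \<in> carrier L" using a by (simp add: join_prime_def)
  have "f a \<sqsubseteq>\<^bsub>M\<^esub> f b \<or> f a \<sqsubseteq>\<^bsub>M\<^esub> f c"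
    if "b \<in> carrier L" "c \<in> carrier L" "is_lub M d {f b, f c}" "f a \<sqsubseteq>\<^bsub>M\<^esub> d" for b c d
  proof -
    \<comment> \<open>By surjectivity the join \<open>d\<close> pulls back to a join
      \<open>e\<close> of \<open>b\<close> and \<open>c\<close>, where primality of \<open>a\<close>
      applies.\<close>
    from that(3) obtain e where e: "e \<in> carrier L" "d = f e"
      by (auto simp: is_lub_iff image_carrier)
    have "is_lub L e {b, c}"
      using is_lub_image[of "{b, c}" e] that e by simp
    moreover have "a \<sqsubseteq>\<^bsub>L\<^esub> e" using that e aL by (simp add: le_iff)
    ultimately show ?thesis
      using a that aL unfolding join_prime_def by (auto simp: le_iff)
  qed
  moreover have "\<exists>b\<in>carrier M. \<not> f a \<sqsubseteq>\<^bsub>M\<^esub> b"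
    using a by (auto simp: join_prime_def image_carrier le_iff)
  ultimately show ?thesis
    using aL by (auto simp: join_prime_def image_carrier)
qed

text \<open>Turns invariance of a property under \<open>f\<close> and its inverse into a bijection;
  serves for join primes and for \<open>prime_compact\<close>.\<close>

lemma bij_betw_Collect:
  assumes "\<And>a. P a \<Longrightarrow> a \<in> carrier L" "\<And>b. Q b \<Longrightarrow> b \<in> carrier M"
    and "\<And>a. P a \<Longrightarrow> Q (f a)" "\<And>b. Q b \<Longrightarrow> P (inv_into (carrier L) f b)"
  shows "bij_betw f {a. P a} {b. Q b}"
proof (rule bij_betw_byWitness[where f' = "inv_into (carrier L) f"])
  show "\<forall>a\<in>{a. P a}. inv_into (carrier L) f (f a) = a"
    using assms(1) by (auto intro: bij_betw_inv_into_left[OF bij])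
  show "\<forall>b\<in>{b. Q b}. f (inv_into (carrier L) f b) = b"
    using assms(2) by (auto intro: bij_betw_inv_into_right[OF bij])
qed (use assms(3,4) in auto)

lemma order_iso_primes: "order_iso (primes L) (primes M) f"
proof
  show "bij_betw f (carrier (primes L)) (carrier (primes M))"
    using bij_betw_Collect[of "join_prime L" "join_prime M", OF _ _ join_prime_map
        order_iso.join_prime_map[OF inverse]]
    by (simp add: primes_def join_prime_def)
qed (simp add: primes_def join_prime_def le_iff)

lemma prime_compact_map:
  assumes a: "prime_compact L a"
  shows "prime_compact M (f a)"
  unfolding prime_compact_def
proof (intro conjI allI impI)
  show "join_prime M (f a)"
    using a by (simp add: prime_compact_def join_prime_map)
next
  fix T assume T: "scott_closed (primes M) T" and lub: "is_lub M (f a) T"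
  \<comment> \<open>\<open>f\<close> acts on two levels: between the primes it transports
    Scott-closedness, between \<open>L\<close> and \<open>M\<close> it transports suprema.\<close>
  interpret p: order_iso "primes L" "primes M" f by (rule order_iso_primes)
  define S where "S = {x \<in> carrier (primes L). f x \<in> T}"
  have S: "scott_closed (primes L) S"
    unfolding S_def using T by (rule p.scott_closed_vimage)
  \<comment> \<open>Members of \<open>T\<close> are join primes of \<open>M\<close>, hence images of
    join primes of \<open>L\<close>, so \<open>T\<close> is recovered from its preimage.\<close>
  have "T \<subseteq> f ` carrier (primes L)"
    using T by (simp add: scott_closed_def p.image_carrier)
  then have TS: "T = f ` S" by (auto simp: S_def)
  have "S \<subseteq> carrier L" "a \<in> carrier L"
    using a by (auto simp: S_def primes_def join_prime_def prime_compact_def)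
  then have "is_lub L a S" using lub by (simp add: TS is_lub_image)
  then have "a \<in> S" using a S by (simp add: prime_compact_def)
  then show "f a \<in> T" by (simp add: S_def)
qed

lemma bij_betw_prime_compact: "bij_betw f {a. prime_compact L a} {b. prime_compact M b}"
  using prime_compact_map order_iso.prime_compact_map[OF inverse]
  by (intro bij_betw_Collect) (auto simp: join_prime_def prime_compact_def)

end

section \<open>Order isomorphism as a symmetric and transitive relation\<close>

lemma weak_partial_order_inclusion_order: "weak_partial_order (inclusion_order X)"
  using partial_order_inclusion_order by (rule partial_order.axioms)

lemma order_isomorphic_iff:
  "order_isomorphic L M \<longleftrightarrow>
    weak_partial_order L \<and> weak_partial_order M \<and> (\<exists>f. order_iso L M f)"
  by (auto simp: order_isomorphic_def order_emb_def order_iso_def)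

lemma order_isomorphic_sym: "order_isomorphic L M \<Longrightarrow> order_isomorphic M L"
  unfolding order_isomorphic_iff using order_iso.inverse by blast

lemma order_isomorphic_trans:
  assumes "order_isomorphic L M" "order_isomorphic M N"
  shows "order_isomorphic L N"
proof -
  from assms obtain f g where f: "order_iso L M f" and g: "order_iso M N g"
    by (auto simp: order_isomorphic_iff)
  interpret f: order_iso L M f by fact
  interpret g: order_iso M N g by fact
  have "order_iso L N (g \<circ> f)"
    using bij_betw_trans[OF f.bij g.bij]
    by unfold_locales (simp_all add: f.le_iff g.le_iff f.map_closed)
  with assms show ?thesis by (auto simp: order_isomorphic_iff)
qed

section \<open>Closed irreducible sets as the join primes of \<open>Gamma\<close>\<close>

lemma scott_closed_Un:
  assumes B: "scott_closed L B" and C: "scott_closed L C"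
  shows "scott_closed L (B \<union> C)"
  unfolding scott_closed_def
proof (intro conjI ballI allI impI)
  fix S s assume S: "directed L S" "S \<subseteq> B \<union> C" "is_lub L s S"
  \<comment> \<open>A directed set covered by two lower sets lies in one of them: if
    \<open>x\<close> escapes \<open>C\<close>, a bound \<open>w\<close> of \<open>x\<close> and any
    \<open>z\<close> escapes \<open>C\<close> too, so \<open>w\<close>, and with it
    \<open>z\<close>, lies in \<open>B\<close>.\<close>
  have "S \<subseteq> B \<or> S \<subseteq> C"
  proof (rule disjCI)
    assume "\<not> S \<subseteq> C"
    then obtain x where x: "x \<in> S" "x \<notin> C" by blast
    show "S \<subseteq> B"
    proof
      fix z assume "z \<in> S"
      then obtain w where w: "w \<in> S" "x \<sqsubseteq>\<^bsub>L\<^esub> w" "z \<sqsubseteq>\<^bsub>L\<^esub> w"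
        using S(1) x unfolding directed_def by blast
      have "S \<subseteq> carrier L" using S(1) by (simp add: directed_def)
      then have "w \<notin> C" using C x w unfolding scott_closed_def by blast
      then have "w \<in> B" using w S(2) by blast
      then show "z \<in> B"
        using B w \<open>z \<in> S\<close> \<open>S \<subseteq> carrier L\<close> unfolding scott_closed_def by blast
    qed
  qed
  then show "s \<in> B \<union> C" using B C S unfolding scott_closed_def by blast
qed (use B C in \<open>auto simp: scott_closed_def\<close>)

lemma scott_closed_empty: "scott_closed L {}"
  by (auto simp: scott_closed_def directed_def)

lemma carrier_Gamma [simp]: "carrier (Gamma L) = {C. scott_closed L C}"
  and le_Gamma [simp]: "le (Gamma L) = (\<subseteq>)"
  and carrier_Irr [simp]: "carrier (Irr L) = {A. scott_closed L A \<and> irreducible L A}"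
  and le_Irr [simp]: "le (Irr L) = (\<subseteq>)"
  by (simp_all add: Gamma_def Irr_def inclusion_order_def)

text \<open>Binary joins in \<open>Gamma L\<close> are unions, which turns primality into
  irreducibility.\<close>

lemma join_prime_Gamma:
  "join_prime (Gamma L) A \<longleftrightarrow> scott_closed L A \<and> irreducible L A"
proof -
  have lub: "is_lub (Gamma L) D {B, C} \<longleftrightarrow> D = B \<union> C"
    if "scott_closed L B" "scott_closed L C" for B C D
    using that scott_closed_Un[OF that] by (auto simp: is_lub_iff)
  \<comment> \<open>The empty set is closed, so it is a closed set failing to contain any nonempty
    \<open>A\<close>.\<close>
  have "(\<exists>B. scott_closed L B \<and> \<not> A \<subseteq> B) \<longleftrightarrow> A \<noteq> {}"
    using scott_closed_empty by auto
  then show ?thesis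
    unfolding join_prime_def irreducible_def
    by (auto simp: lub) (auto simp: scott_closed_def)
qed

text \<open>Identifies the families tested by \<open>prime_compact\<close> in \<open>Gamma L\<close>
  with the Scott-closed subsets of \<open>Irr L\<close>, where domination is stated.\<close>

lemma primes_Gamma: "primes (Gamma L) = Irr L"
  by (simp add: primes_def join_prime_Gamma) (simp add: Gamma_def Irr_def inclusion_order_def)

section \<open>Principal ideals\<close>

context partial_order
begin

lemma mem_down_self: "x \<in> carrier L \<Longrightarrow> x \<in> down L x"
  by (simp add: down_def)

lemma down_subset: "scott_closed L A \<Longrightarrow> x \<in> A \<Longrightarrow> down L x \<subseteq> A"
  by (auto simp: scott_closed_def down_def)

lemma down_subset_iff:
  assumes "x \<in> carrier L" "y \<in> carrier L"
  shows "down L x \<subseteq> down L y \<longleftrightarrow> x \<sqsubseteq> y"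
  using assms by (auto simp: down_def intro: le_trans)

lemma scott_closed_down:
  assumes x: "x \<in> carrier L"
  shows "scott_closed L (down L x)"
  using x unfolding scott_closed_def
proof (intro conjI ballI allI impI)
  fix S s assume "S \<subseteq> down L x" "is_lub L s S"
  then show "s \<in> down L x" using x by (auto simp: is_lub_iff down_def)
qed (auto simp: down_def intro: le_trans)

text \<open>\<open>x\<close> itself falls into \<open>B\<close> or \<open>C\<close>, and a lower set
  containing it contains its whole ideal.\<close>

lemma irreducible_down:
  assumes x: "x \<in> carrier L"
  shows "irreducible L (down L x)"
  unfolding irreducible_def
proof (intro conjI allI impI)
  fix B C assume "scott_closed L B" "scott_closed L C" "down L x \<subseteq> B \<union> C"
  then show "down L x \<subseteq> B \<or> down L x \<subseteq> C"
    using mem_down_self[OF x] down_subset by blast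
qed (use mem_down_self[OF x] in \<open>auto simp: down_def\<close>)

text \<open>The reason is that \<open>down L\<close> is Scott-continuous from \<open>L\<close> to
  \<open>Irr L\<close>: it is monotone and carries existing directed suprema to suprema.\<close>

lemma scott_closed_vimage_down:
  assumes S: "scott_closed (Irr L) S"
  shows "scott_closed L {x \<in> carrier L. down L x \<in> S}"
  unfolding scott_closed_def
proof (intro conjI ballI allI impI)
  fix x y assume "x \<in> {x \<in> carrier L. down L x \<in> S}" "y \<in> carrier L" "y \<sqsubseteq> x"
  then show "y \<in> {x \<in> carrier L. down L x \<in> S}"
    using S scott_closed_down irreducible_down down_subset_iff
    unfolding scott_closed_def[of "Irr L"] by auto
next
  fix T t assume T: "directed L T" "T \<subseteq> {x \<in> carrier L. down L x \<in> S}" "is_lub L t T"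
  have t: "t \<in> carrier L" using T(3) by (simp add: is_lub_iff)
  have TL: "T \<subseteq> carrier L" using T(2) by auto
  have dir: "directed (Irr L) (down L ` T)"
    using T(1) TL unfolding directed_def
    by (simp add: image_subset_iff subset_iff[of T] scott_closed_down irreducible_down)
      (metis down_subset_iff)
  have "is_lub (Irr L) (down L t) (down L ` T)"
    unfolding is_lub_iff
  proof (intro conjI ballI impI)
    show "down L t \<in> carrier (Irr L)"
      using t by (simp add: scott_closed_down irreducible_down)
  next
    fix A assume "A \<in> down L ` T \<inter> carrier (Irr L)"
    then obtain x where "x \<in> T" "A = down L x" by blast
    moreover have "x \<in> carrier L" "x \<sqsubseteq> t"
      using T(3) TL \<open>x \<in> T\<close> by (auto simp: is_lub_iff)
    ultimately show "A \<sqsubseteq>\<^bsub>Irr L\<^esub> down L t"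
      using t by (simp add: down_subset_iff)
  next
    fix U assume U: "U \<in> carrier (Irr L)"
      and ub: "\<forall>A\<in>down L ` T \<inter> carrier (Irr L). A \<sqsubseteq>\<^bsub>Irr L\<^esub> U"
    \<comment> \<open>An upper bound \<open>U\<close> contains each point of \<open>T\<close>
      through its ideal; being Scott-closed it contains \<open>t\<close>, hence the ideal of
      \<open>t\<close>.\<close>
    have "T \<subseteq> U"
    proof
      fix x assume "x \<in> T"
      then have x: "x \<in> carrier L" using TL by blast
      then have "down L x \<in> down L ` T \<inter> carrier (Irr L)"
        using \<open>x \<in> T\<close> by (simp add: scott_closed_down irreducible_down)
      then show "x \<in> U" using ub mem_down_self[OF x] by auto
    qed
    then have "t \<in> U" using U T(1,3) by (simp add: scott_closed_def)
    then show "down L t \<sqsubseteq>\<^bsub>Irr L\<^esub> U" using U by (simp add: down_subset)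
  qed
  then have "down L t \<in> S"
    using S dir T(2) unfolding scott_closed_def by blast
  with t show "t \<in> {x \<in> carrier L. down L x \<in> S}" by simp
qed auto

lemma prime_compact_down:
  assumes x: "x \<in> carrier L"
  shows "prime_compact (Gamma L) (down L x)"
  unfolding prime_compact_def primes_Gamma
proof (intro conjI allI impI)
  show "join_prime (Gamma L) (down L x)"
    using x by (simp add: join_prime_Gamma scott_closed_down irreducible_down)
next
  fix S assume S: "scott_closed (Irr L) S" and lub: "is_lub (Gamma L) (down L x) S"
  define C where "C = {y \<in> carrier L. down L y \<in> S}"
  have "scott_closed L C" unfolding C_def using S by (rule scott_closed_vimage_down)
  \<comment> \<open>\<open>S\<close> is a lower set in \<open>Irr L\<close>, so it contains the
    ideal of every point of its members.\<close>
  moreover have "A \<subseteq> C" if "A \<in> S" for A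
  proof
    fix y assume "y \<in> A"
    have A: "scott_closed L A" using S that by (auto simp: scott_closed_def[of "Irr L"])
    then have "y \<in> carrier L" using \<open>y \<in> A\<close> by (auto simp: scott_closed_def)
    moreover have "down L y \<subseteq> A" using A \<open>y \<in> A\<close> by (rule down_subset)
    ultimately show "y \<in> C"
      using S that by (auto simp: C_def scott_closed_def[of "Irr L"] scott_closed_down irreducible_down)
  qed
  \<comment> \<open>\<open>C\<close> bounds \<open>S\<close> in \<open>Gamma L\<close> without being
    known to be irreducible, so it is the supremum in \<open>Gamma L\<close> that can be compared
    with it.\<close>
  ultimately have "down L x \<subseteq> C" using lub by (simp add: is_lub_iff)
  then show "down L x \<in> S" using mem_down_self[OF x] by (auto simp: C_def)
qed

text \<open>Each point of \<open>A\<close> contributes its own ideal, so a closed upper bound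
  contains \<open>A\<close>; conversely each member lies below a point of \<open>A\<close>, hence
  inside \<open>A\<close>.\<close>

lemma is_lub_nabla:
  assumes A: "A \<in> carrier (Irr L)"
  shows "is_lub (Gamma L) A (nabla L A)"
  unfolding is_lub_iff
proof (intro conjI ballI impI)
  show "A \<in> carrier (Gamma L)" using A by simp
next
  fix B assume "B \<in> nabla L A \<inter> carrier (Gamma L)"
  then show "B \<sqsubseteq>\<^bsub>Gamma L\<^esub> A"
    using A down_subset by (fastforce simp: nabla_def triangle_below_def)
next
  fix U assume ub: "\<forall>B\<in>nabla L A \<inter> carrier (Gamma L). B \<sqsubseteq>\<^bsub>Gamma L\<^esub> U"
  have "x \<in> U" if "x \<in> A" for x
  proof -
    have x: "x \<in> carrier L" using A that by (auto simp: scott_closed_def)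
    then have "down L x \<in> nabla L A \<inter> carrier (Gamma L)"
      using that by (auto simp: nabla_def triangle_below_def scott_closed_down irreducible_down)
    then show "x \<in> U" using ub mem_down_self[OF x] by auto
  qed
  then show "A \<sqsubseteq>\<^bsub>Gamma L\<^esub> U" by auto
qed

end

section \<open>Recovering a dominated dcpo from its lattice of closed sets\<close>

context dominated_dcpo
begin

lemma prime_compact_iff_principal: "prime_compact (Gamma L) A \<longleftrightarrow> A \<in> down L ` carrier L"
proof
  assume A: "prime_compact (Gamma L) A"
  then have AI: "A \<in> carrier (Irr L)"
    by (simp add: prime_compact_def join_prime_Gamma)
  \<comment> \<open>Domination makes \<open>nabla L A\<close> an admissible test family with
    supremum \<open>A\<close>; membership then yields a point of \<open>A\<close> whose ideal
    contains \<open>A\<close>.\<close>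
  then have "A \<in> nabla L A"
    using A nabla_scott_closed is_lub_nabla by (simp add: prime_compact_def primes_Gamma)
  then obtain x where "x \<in> A" "A \<subseteq> down L x"
    by (auto simp: nabla_def triangle_below_def)
  moreover have "down L x \<subseteq> A" "x \<in> carrier L"
    using AI \<open>x \<in> A\<close> down_subset by (auto simp: scott_closed_def)
  ultimately show "A \<in> down L ` carrier L" by blast
qed (auto simp: prime_compact_down)

text \<open>\<open>down L\<close> preserves and reflects the order, hence is injective, and its
  image is exactly the set of compact primes.\<close>

lemma order_isomorphic_prime_compact:
  "order_isomorphic L (inclusion_order {A. prime_compact (Gamma L) A})"
proof -
  have "inj_on (down L) (carrier L)"
  proof (rule inj_onI)
    fix x y assume "x \<in> carrier L" "y \<in> carrier L" "down L x = down L y"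
    then show "x = y" using down_subset_iff[of x y] down_subset_iff[of y x] by auto
  qed
  then have "bij_betw (down L) (carrier L) {A. prime_compact (Gamma L) A}"
    by (auto simp: bij_betw_def prime_compact_iff_principal)
  then have "order_iso L (inclusion_order {A. prime_compact (Gamma L) A}) (down L)"
    by unfold_locales (simp_all add: inclusion_order_def down_subset_iff)
  then show ?thesis
    using weak_partial_order_axioms
    by (auto simp: order_isomorphic_iff weak_partial_order_inclusion_order)
qed

end

theorem theorem2p14:
  fixes D :: "'a gorder" and E :: "'b gorder"
  assumes "dominated_dcpo D"
    and "dominated_dcpo E"
    and "order_isomorphic (Gamma D) (Gamma E)"
  shows "order_isomorphic D E"
proof -
  obtain f where "order_iso (Gamma D) (Gamma E) f"
    using assms(3) by (auto simp: order_isomorphic_iff)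
  then interpret f: order_iso "Gamma D" "Gamma E" f .
  \<comment> \<open>\<open>?K\<close> and \<open>?K'\<close> are copies of \<open>D\<close> and
    \<open>E\<close>, and \<open>f\<close> restricts to a bijection between them because
    \<open>prime_compact\<close> is invariant under isomorphism.\<close>
  let ?K = "inclusion_order {A. prime_compact (Gamma D) A}"
  let ?K' = "inclusion_order {A. prime_compact (Gamma E) A}"
  have "order_iso ?K ?K' f"
    using f.bij_betw_prime_compact f.le_iff
    by unfold_locales (simp_all add: inclusion_order_def prime_compact_def join_prime_def)
  then have "order_isomorphic ?K ?K'"
    by (auto simp: order_isomorphic_iff weak_partial_order_inclusion_order)
  then show ?thesis
    using dominated_dcpo.order_isomorphic_prime_compact[OF assms(1)]
      dominated_dcpo.order_isomorphic_prime_compact[OF assms(2)]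
    by (blast intro: order_isomorphic_trans order_isomorphic_sym)
qed

end
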